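(* Let $A$ be a Banach algebra, $X$ a Banach $A$-module and $\varphi\in\triangle(A)$. Then $A\oplus X$ is $(\varphi,0)$-inner amenable if and only if there exists a bounded net $(a_\alpha,x_\alpha)$ in $A\oplus X$ satisfying (i) $\|aa_\alpha-a_\alpha a\|\to 0$ for all $a\in A$ and $\varphi(a_\alpha)=1$ for all $\alpha$, (ii) $\|xa_\alpha-a_\alpha x\|\to 0$ for all $x\in X$, and (iii) $\|ax_\alpha-x_\alpha a\|\to 0$ for all $a\in A$.
   Context: Banach algebras are over $\mathbb{C}$. $\triangle(A)$ denotes the spectrum of $A$, i.e. the set of all nonzero multiplicative linear functionals $\varphi:A\to\mathbb{C}$. For $a,b\in A$ and $f\in A^*$, define $f\cdot a, a\cdot f\in A^*$ by $\langle f\cdot a,b\rangle=\langle f,ab\rangle$ and $\langle a\cdot f,b\rangle=\langle f,ba\rangle$. For $\varphi\in\triangle(A)$, $A$ is called $\varphi$-inner amenable if there exists $m\in A^{**}$ with $m(\varphi)=1$ and $m(f\cdot a)=m(a\cdot f)$ for all $f\in A^*$, $a\in A$. A Banach $A$-module $X$ is a two-sided one (a Banach space that is an $A$-bimodule with $\|ax\|\le\|a\|\|x\|$ and $\|xa\|\le\|x\|\|a\|$). The module extension Banach algebra $A\oplus X$ has product $(a,x)\cdot(b,y)=(ab,ay+xb)$ and norm $\|(a,x)\|=\|a\|+\|x\|$. The character $(\varphi,0)\in\triangle(A\oplus X)$ is given by $(\varphi,0)((a,x))=\varphi(a)$. *)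

theory Defs
  imports "HOL-Analysis.Analysis"
begin

section \<open>Complex Banach spaces and their duals\<close>

class scaleC =
  fixes scaleC :: "complex \<Rightarrow> 'a \<Rightarrow> 'a" (infixr \<open>*\<^sub>C\<close> 75)

class complex_normed_vector = scaleC + real_normed_vector +
  assumes scaleC_add_right: "c *\<^sub>C (x + y) = c *\<^sub>C x + c *\<^sub>C y"
    and scaleC_add_left: "(c + d) *\<^sub>C x = c *\<^sub>C x + d *\<^sub>C x"
    and scaleC_scaleC: "c *\<^sub>C d *\<^sub>C x = (c * d) *\<^sub>C x"
    and scaleC_of_real: "complex_of_real t *\<^sub>C x = t *\<^sub>R x"
    and norm_scaleC: "norm (c *\<^sub>C x) = cmod c * norm x"

class complex_banach = complex_normed_vector + banach

lemma scaleC_one: "1 *\<^sub>C x = (x :: 'a :: complex_normed_vector)"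
  using scaleC_of_real[of 1 x] by simp

lemma vector_space_scaleC:
  "vector_space (scaleC :: complex \<Rightarrow> 'a \<Rightarrow> 'a :: complex_normed_vector)"
  by standard (simp_all add: scaleC_add_right scaleC_add_left scaleC_scaleC scaleC_one)

abbreviation clinear :: "('a::complex_normed_vector \<Rightarrow> complex) \<Rightarrow> bool" where
  "clinear \<equiv> Vector_Spaces.linear scaleC (*)"

lemma clinear_iff:
  "clinear f \<longleftrightarrow> (\<forall>x y. f (x + y) = f x + f y) \<and> (\<forall>c x. f (c *\<^sub>C x) = c * f x)"
proof -
  have "vector_space ((*) :: complex \<Rightarrow> complex \<Rightarrow> complex)"
    by standard (simp_all add: algebra_simps)
  then show ?thesis
    by (simp add: Vector_Spaces.linear_iff vector_space_scaleC)
qed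

typedef (overloaded) 'a cdual =
  "{f :: 'a::complex_normed_vector \<Rightarrow> complex. clinear f \<and> bounded_linear f}"
  morphisms cdual_apply Cdual
  by (rule exI[of _ "\<lambda>_. 0"]) (simp add: clinear_iff bounded_linear_zero)

declare [[coercion cdual_apply]]

setup_lifting type_definition_cdual

instantiation cdual :: (complex_normed_vector) complex_normed_vector
begin

lift_definition norm_cdual :: "'a cdual \<Rightarrow> real" is onorm .

lift_definition minus_cdual :: "'a cdual \<Rightarrow> 'a cdual \<Rightarrow> 'a cdual" is "\<lambda>f g x. f x - g x"
  by (auto simp: clinear_iff algebra_simps intro: bounded_linear_sub)

lift_definition uminus_cdual :: "'a cdual \<Rightarrow> 'a cdual" is "\<lambda>f x. - f x"
  by (auto simp: clinear_iff algebra_simps intro: bounded_linear_minus)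

lift_definition zero_cdual :: "'a cdual" is "\<lambda>x. 0"
  by (auto simp: clinear_iff)

lift_definition plus_cdual :: "'a cdual \<Rightarrow> 'a cdual \<Rightarrow> 'a cdual" is "\<lambda>f g x. f x + g x"
  by (auto simp: clinear_iff algebra_simps intro: bounded_linear_add)

lift_definition scaleC_cdual :: "complex \<Rightarrow> 'a cdual \<Rightarrow> 'a cdual" is "\<lambda>c f x. c * f x"
  by (auto simp: clinear_iff algebra_simps
      intro: bounded_linear_compose[OF bounded_linear_mult_right])

lift_definition scaleR_cdual :: "real \<Rightarrow> 'a cdual \<Rightarrow> 'a cdual" is "\<lambda>t f x. t *\<^sub>R f x"
  by (auto simp: clinear_iff algebra_simps
      intro: bounded_linear_compose[OF bounded_linear_scaleR_right])

definition dist_cdual :: "'a cdual \<Rightarrow> 'a cdual \<Rightarrow> real" where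
  "dist_cdual f g = norm (f - g)"

definition uniformity_cdual :: "('a cdual \<times> 'a cdual) filter" where
  "uniformity_cdual = (INF e\<in>{0<..}. principal {(f, g). dist f g < e})"

definition open_cdual :: "'a cdual set \<Rightarrow> bool" where
  "open_cdual S = (\<forall>f\<in>S. \<forall>\<^sub>F (f', g) in uniformity. f' = f \<longrightarrow> g \<in> S)"

definition sgn_cdual :: "'a cdual \<Rightarrow> 'a cdual" where
  "sgn_cdual f = scaleR (inverse (norm f)) f"

lemma onorm_cmult:
  fixes f :: "'b::real_normed_vector \<Rightarrow> complex"
  assumes "bounded_linear f"
  shows "onorm (\<lambda>x. c * f x) = cmod c * onorm f"
proof (cases "c = 0")
  case True
  then show ?thesis by (simp add: onorm_zero)
next
  case False
  have le: "onorm (\<lambda>x. d * g x) \<le> cmod d * onorm g"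
    if "bounded_linear g" for d and g :: "'b \<Rightarrow> complex"
    using that
    by (intro onorm_bound)
      (auto simp: norm_mult mult.assoc intro!: mult_left_mono onorm mult_nonneg_nonneg onorm_pos_le)
  have "onorm f \<le> cmod (inverse c) * onorm (\<lambda>x. c * f x)"
    using le[OF bounded_linear_compose[OF bounded_linear_mult_right assms], of "inverse c" c] False
    by (simp add: mult.assoc[symmetric])
  then have "cmod c * onorm f \<le> onorm (\<lambda>x. c * f x)"
    using False by (simp add: norm_inverse norm_divide field_simps)
  with le[OF assms, of c] show ?thesis by simp
qed

instance
proof
  fix f g h :: "'a cdual" and c d :: complex and s t :: real
  show "dist f g = norm (f - g)"
    "(uniformity :: ('a cdual \<times> 'a cdual) filter)
      = (INF e\<in>{0<..}. principal {(f, g). dist f g < e})"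
    "open S = (\<forall>f\<in>S. \<forall>\<^sub>F (f', g) in uniformity. f' = f \<longrightarrow> g \<in> S)"
    "sgn f = inverse (norm f) *\<^sub>R f" for S :: "'a cdual set"
    by (simp_all only: dist_cdual_def uniformity_cdual_def open_cdual_def sgn_cdual_def)
  show "f + g + h = f + (g + h)" "f + g = g + f" "0 + f = f" "- f + f = 0" "f - g = f + - g"
    "t *\<^sub>R (f + g) = t *\<^sub>R f + t *\<^sub>R g" "(s + t) *\<^sub>R f = s *\<^sub>R f + t *\<^sub>R f"
    "s *\<^sub>R t *\<^sub>R f = (s * t) *\<^sub>R f" "1 *\<^sub>R f = f"
    "c *\<^sub>C (f + g) = c *\<^sub>C f + c *\<^sub>C g" "(c + d) *\<^sub>C f = c *\<^sub>C f + d *\<^sub>C f"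
    "c *\<^sub>C d *\<^sub>C f = (c * d) *\<^sub>C f" "complex_of_real t *\<^sub>C f = t *\<^sub>R f"
    by (transfer, simp add: algebra_simps scaleR_conv_of_real)+
  show "(norm f = 0) = (f = 0)"
    by transfer (auto simp: onorm_eq_0)
  show "norm (f + g) \<le> norm f + norm g"
    by transfer (auto simp: onorm_triangle)
  show "norm (t *\<^sub>R f) = \<bar>t\<bar> * norm f"
    by transfer (auto simp: onorm_scaleR)
  show "norm (c *\<^sub>C f) = cmod c * norm f"
    by transfer (auto simp: onorm_cmult)
qed

end

lemma cdual_apply_Cdual:
  assumes "clinear f" "\<And>x. cmod (f x) \<le> K * norm x"
  shows "cdual_apply (Cdual f) = f"
proof -
  have "bounded_linear f"
  proof (rule bounded_linear_intro)
    show "f (x + y) = f x + f y" for x y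
      using assms(1) by (simp add: clinear_iff)
    show "f (t *\<^sub>R x) = t *\<^sub>R f x" for t x
      using assms(1) scaleC_of_real[of t x] by (metis clinear_iff scaleR_conv_of_real)
    show "norm (f x) \<le> norm x * K" for x
      using assms(2)[of x] by (simp add: mult.commute)
  qed
  then show ?thesis
    using assms(1) by (simp add: Cdual_inverse)
qed


section \<open>Banach algebras, characters and inner amenability\<close>

text \<open>The multiplication is an explicit parameter, since the one on the module extension depends on
  the module actions. No unit is assumed.\<close>

locale complex_banach_algebra =
  fixes mul :: "'a::complex_banach \<Rightarrow> 'a \<Rightarrow> 'a"
  assumes mul_assoc: "mul (mul a b) c = mul a (mul b c)"
    and mul_add_left: "mul (a + b) c = mul a c + mul b c"
    and mul_add_right: "mul a (b + c) = mul a b + mul a c"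
    and mul_scaleC_left: "mul (z *\<^sub>C a) b = z *\<^sub>C mul a b"
    and mul_scaleC_right: "mul a (z *\<^sub>C b) = z *\<^sub>C mul a b"
    and norm_mul: "norm (mul a b) \<le> norm a * norm b"

definition characters :: "('a::complex_banach \<Rightarrow> 'a \<Rightarrow> 'a) \<Rightarrow> ('a \<Rightarrow> complex) set" where
  "characters mul =
    {\<phi>. clinear \<phi> \<and> (\<forall>a b. \<phi> (mul a b) = \<phi> a * \<phi> b) \<and> (\<exists>a. \<phi> a \<noteq> 0)}"

text \<open>\<open>dual_right mul f a\<close> is \<open>f \<cdot> a\<close> and \<open>dual_left mul a f\<close> is \<open>a \<cdot> f\<close>.\<close>

definition dual_right ::
  "('a::complex_banach \<Rightarrow> 'a \<Rightarrow> 'a) \<Rightarrow> 'a cdual \<Rightarrow> 'a \<Rightarrow> 'a cdual" where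
  "dual_right mul f a = Cdual (\<lambda>b. f (mul a b))"

definition dual_left ::
  "('a::complex_banach \<Rightarrow> 'a \<Rightarrow> 'a) \<Rightarrow> 'a \<Rightarrow> 'a cdual \<Rightarrow> 'a cdual" where
  "dual_left mul a f = Cdual (\<lambda>b. f (mul b a))"

text \<open>Characters are not assumed continuous; \<open>Cdual \<phi>\<close> is nevertheless the character \<open>\<phi>\<close> as an element
  of the dual, by lemma \<open>Cdual_character\<close> below.\<close>

definition inner_amenable ::
  "('a::complex_banach \<Rightarrow> 'a \<Rightarrow> 'a) \<Rightarrow> ('a \<Rightarrow> complex) \<Rightarrow> bool" where
  "inner_amenable mul \<phi> \<longleftrightarrow>
    (\<exists>m :: 'a cdual cdual. m (Cdual \<phi>) = 1 \<and>
      (\<forall>f a. m (dual_right mul f a) = m (dual_left mul a f)))"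

lemma cdual_clinear: "clinear (cdual_apply f)"
  using cdual_apply[of f] by simp

lemma cdual_norm_le: "cmod (cdual_apply f x) \<le> norm f * norm x"
  using cdual_apply[of f] by transfer (simp add: onorm)

context complex_banach_algebra
begin

lemma dual_right_apply: "dual_right mul f a b = f (mul a b)"
proof -
  have "cmod (f (mul a x)) \<le> (norm f * norm a) * norm x" for x
    using order_trans[OF cdual_norm_le mult_left_mono[OF norm_mul norm_ge_zero]]
    by (simp add: mult.assoc)
  moreover have "clinear (\<lambda>x. f (mul a x))"
    using cdual_clinear[of f] by (simp add: clinear_iff mul_add_right mul_scaleC_right)
  ultimately show ?thesis
    unfolding dual_right_def by (subst cdual_apply_Cdual) auto
qed

lemma dual_left_apply: "dual_left mul a f b = f (mul b a)"
proof -
  have "cmod (f (mul x a)) \<le> (norm f * norm a) * norm x" for x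
    using order_trans[OF cdual_norm_le mult_left_mono[OF norm_mul norm_ge_zero], of f x a]
    by (simp add: ac_simps)
  moreover have "clinear (\<lambda>x. f (mul x a))"
    using cdual_clinear[of f] by (simp add: clinear_iff mul_add_left mul_scaleC_left)
  ultimately show ?thesis
    unfolding dual_left_def by (subst cdual_apply_Cdual) auto
qed

lemma character_norm_le:
  assumes "\<phi> \<in> characters mul"
  shows "cmod (\<phi> a) \<le> norm a"
proof (rule ccontr)
  assume "\<not> cmod (\<phi> a) \<le> norm a"
  then have gt: "norm a < cmod (\<phi> a)" by simp
  then have nz: "\<phi> a \<noteq> 0" by (metis norm_ge_zero norm_zero not_le)
  have phi: "\<phi> (x + y) = \<phi> x + \<phi> y" "\<phi> (z *\<^sub>C x) = z * \<phi> x" "\<phi> (mul x y) = \<phi> x * \<phi> y" for x y z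
    using assms by (auto simp: characters_def clinear_iff)
  define b where "b = inverse (\<phi> a) *\<^sub>C a"
  have phib: "\<phi> b = 1" using nz by (simp add: b_def phi)
  have nb: "norm b < 1"
    using gt nz by (simp add: b_def norm_scaleC norm_inverse norm_divide field_simps)
  define p where "p n = (mul b ^^ n) b" for n
  have p_norm: "norm (p n) \<le> norm b ^ n * norm b" for n
  proof (induction n)
    case 0
    then show ?case by (simp add: p_def)
  next
    case (Suc n)
    have "norm (p (Suc n)) \<le> norm b * norm (p n)"
      using norm_mul by (simp add: p_def)
    also have "\<dots> \<le> norm b * (norm b ^ n * norm b)"
      using Suc by (intro mult_left_mono) auto
    finally show ?case by (simp add: mult.assoc)
  qed
  have summ: "summable p"
    by (rule summable_comparison_test'[of "\<lambda>n. norm b ^ n * norm b" 0])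
      (use nb p_norm in \<open>auto intro: summable_mult2 summable_geometric\<close>)
  have bl: "bounded_linear (mul b)"
  proof (rule bounded_linear_intro)
    show "mul b (x + y) = mul b x + mul b y" for x y by (rule mul_add_right)
    show "mul b (t *\<^sub>R x) = t *\<^sub>R mul b x" for t x
      using mul_scaleC_right[of b "of_real t" x] by (simp add: scaleC_of_real)
    show "norm (mul b x) \<le> norm x * norm b" for x
      using norm_mul[of b x] by (simp add: mult.commute)
  qed
  define c where "c = suminf p"
  have "c = p 0 + (\<Sum>n. p (Suc n))"
    unfolding c_def using suminf_split_head[OF summ] by simp
  also have "(\<Sum>n. p (Suc n)) = mul b c"
    unfolding c_def using bounded_linear.suminf[OF bl summ] by (simp add: p_def[abs_def])
  finally have "c = b + mul b c" by (simp add: p_def)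
  then have "\<phi> c = \<phi> b + \<phi> b * \<phi> c" by (metis phi(1,3))
  then show False by (simp add: phib)
qed

lemma Cdual_character:
  assumes "\<phi> \<in> characters mul"
  shows "cdual_apply (Cdual \<phi>) = \<phi>"
  using assms character_norm_le[OF assms]
  by (intro cdual_apply_Cdual[where K = 1]) (auto simp: characters_def)

end


section \<open>Banach modules and module extensions\<close>

locale banach_bimodule = complex_banach_algebra mul
  for mul :: "'a::complex_banach \<Rightarrow> 'a \<Rightarrow> 'a" +
  fixes lact :: "'a \<Rightarrow> 'x::complex_banach \<Rightarrow> 'x"
    and ract :: "'x \<Rightarrow> 'a \<Rightarrow> 'x"
  assumes lact_add_left: "lact (a + b) x = lact a x + lact b x"
    and lact_add_right: "lact a (x + y) = lact a x + lact a y"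
    and lact_scaleC_left: "lact (z *\<^sub>C a) x = z *\<^sub>C lact a x"
    and lact_scaleC_right: "lact a (z *\<^sub>C x) = z *\<^sub>C lact a x"
    and ract_add_left: "ract (x + y) a = ract x a + ract y a"
    and ract_add_right: "ract x (a + b) = ract x a + ract x b"
    and ract_scaleC_left: "ract (z *\<^sub>C x) a = z *\<^sub>C ract x a"
    and ract_scaleC_right: "ract x (z *\<^sub>C a) = z *\<^sub>C ract x a"
    and lact_mul: "lact (mul a b) x = lact a (lact b x)"
    and ract_mul: "ract x (mul a b) = ract (ract x a) b"
    and lact_ract: "ract (lact a x) b = lact a (ract x b)"
    and norm_lact: "norm (lact a x) \<le> norm a * norm x"
    and norm_ract: "norm (ract x a) \<le> norm x * norm a"

text \<open>The product type cannot be used for the direct sum: its norm is the Euclidean one.\<close>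

datatype ('a, 'x) module_ext = Ext (alg_part: 'a) (mod_part: 'x)

instantiation module_ext :: (complex_normed_vector, complex_normed_vector) complex_normed_vector
begin

definition "norm u = norm (alg_part u) + norm (mod_part u)"
definition "0 = Ext 0 0"
definition "u + v = Ext (alg_part u + alg_part v) (mod_part u + mod_part v)"
definition "u - v = Ext (alg_part u - alg_part v) (mod_part u - mod_part v)"
definition "- u = Ext (- alg_part u) (- mod_part u)"
definition "c *\<^sub>C u = Ext (c *\<^sub>C alg_part u) (c *\<^sub>C mod_part u)"
definition "t *\<^sub>R u = Ext (t *\<^sub>R alg_part u) (t *\<^sub>R mod_part u)"

definition dist_module_ext :: "('a, 'b) module_ext \<Rightarrow> ('a, 'b) module_ext \<Rightarrow> real" where
  "dist_module_ext u v = norm (u - v)"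

definition uniformity_module_ext :: "(('a, 'b) module_ext \<times> ('a, 'b) module_ext) filter" where
  "uniformity_module_ext = (INF e\<in>{0<..}. principal {(u, v). dist u v < e})"

definition open_module_ext :: "('a, 'b) module_ext set \<Rightarrow> bool" where
  "open_module_ext S = (\<forall>u\<in>S. \<forall>\<^sub>F (u', v) in uniformity. u' = u \<longrightarrow> v \<in> S)"

definition sgn_module_ext :: "('a, 'b) module_ext \<Rightarrow> ('a, 'b) module_ext" where
  "sgn_module_ext u = scaleR (inverse (norm u)) u"

lemmas module_ext_ops = norm_module_ext_def zero_module_ext_def plus_module_ext_def
  minus_module_ext_def uminus_module_ext_def scaleC_module_ext_def scaleR_module_ext_def

instance
proof
  fix u v w :: "('a, 'b) module_ext" and c d :: complex and s t :: real
  show dist: "dist u v = norm (u - v)" for u v :: "('a, 'b) module_ext"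
    by (simp only: dist_module_ext_def)
  show "(uniformity :: (('a, 'b) module_ext \<times> ('a, 'b) module_ext) filter)
      = (INF e\<in>{0<..}. principal {(u, v). dist u v < e})"
    "open S = (\<forall>u\<in>S. \<forall>\<^sub>F (u', v) in uniformity. u' = u \<longrightarrow> v \<in> S)"
    "sgn u = inverse (norm u) *\<^sub>R u" for S :: "('a, 'b) module_ext set"
    by (simp_all only: uniformity_module_ext_def open_module_ext_def sgn_module_ext_def)
  show "u + v + w = u + (v + w)" "u + v = v + u" "0 + u = u" "- u + u = 0" "u - v = u + - v"
    "t *\<^sub>R (u + v) = t *\<^sub>R u + t *\<^sub>R v" "(s + t) *\<^sub>R u = s *\<^sub>R u + t *\<^sub>R u"
    "s *\<^sub>R t *\<^sub>R u = (s * t) *\<^sub>R u" "1 *\<^sub>R u = u"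
    by (simp_all add: module_ext_ops algebra_simps)
  show "c *\<^sub>C (u + v) = c *\<^sub>C u + c *\<^sub>C v" "(c + d) *\<^sub>C u = c *\<^sub>C u + d *\<^sub>C u"
    "c *\<^sub>C d *\<^sub>C u = (c * d) *\<^sub>C u" "complex_of_real t *\<^sub>C u = t *\<^sub>R u"
    by (simp_all add: module_ext_ops scaleC_add_right scaleC_add_left scaleC_scaleC scaleC_of_real)
  show "(norm u = 0) = (u = 0)"
    by (cases u) (simp add: module_ext_ops add_nonneg_eq_0_iff)
  show "norm (u + v) \<le> norm u + norm v"
    using norm_triangle_ineq[of "alg_part u" "alg_part v"]
      norm_triangle_ineq[of "mod_part u" "mod_part v"]
    by (simp add: module_ext_ops)
  show "norm (t *\<^sub>R u) = \<bar>t\<bar> * norm u"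
    by (simp add: module_ext_ops algebra_simps)
  show "norm (c *\<^sub>C u) = cmod c * norm u"
    by (simp add: module_ext_ops norm_scaleC algebra_simps)
qed

end

instance module_ext :: (complex_banach, complex_banach) complex_banach
proof
  fix X :: "nat \<Rightarrow> ('a, 'b) module_ext"
  have dist: "dist u v = norm (alg_part u - alg_part v) + norm (mod_part u - mod_part v)"
    for u v :: "('a, 'b) module_ext"
    by (simp add: dist_module_ext_def module_ext_ops)
  have dist': "dist u v = dist (alg_part u) (alg_part v) + dist (mod_part u) (mod_part v)"
    for u v :: "('a, 'b) module_ext"
    by (simp only: dist dist_norm)
  assume C: "Cauchy X"
  have "Cauchy (\<lambda>n. alg_part (X n))"
    using C unfolding Cauchy_def dist'
    by (meson le_less_trans le_add_same_cancel1 zero_le_dist)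
  moreover have "Cauchy (\<lambda>n. mod_part (X n))"
    using C unfolding Cauchy_def dist'
    by (meson le_less_trans le_add_same_cancel2 zero_le_dist)
  ultimately obtain a x where
    "(\<lambda>n. alg_part (X n)) \<longlonglongrightarrow> a" "(\<lambda>n. mod_part (X n)) \<longlonglongrightarrow> x"
    by (metis Cauchy_convergent_iff convergent_def)
  then have "(\<lambda>n. dist (alg_part (X n)) a + dist (mod_part (X n)) x) \<longlonglongrightarrow> 0 + 0"
    by (intro tendsto_add) (simp_all add: tendsto_dist_iff[symmetric])
  then have "X \<longlonglongrightarrow> Ext a x"
    by (subst tendsto_dist_iff) (simp add: dist')
  then show "convergent X" by (rule convergentI)
qed

definition ext_mul ::
  "('a \<Rightarrow> 'a \<Rightarrow> 'a) \<Rightarrow> ('a \<Rightarrow> 'x \<Rightarrow> 'x) \<Rightarrow> ('x \<Rightarrow> 'a \<Rightarrow> 'x) \<Rightarrow>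
    ('a, 'x::plus) module_ext \<Rightarrow> ('a, 'x) module_ext \<Rightarrow> ('a, 'x) module_ext" where
  "ext_mul mul lact ract u v =
    Ext (mul (alg_part u) (alg_part v))
      (lact (alg_part u) (mod_part v) + ract (mod_part u) (alg_part v))"

definition ext_char :: "('a \<Rightarrow> complex) \<Rightarrow> ('a, 'x) module_ext \<Rightarrow> complex" where
  "ext_char \<phi> u = \<phi> (alg_part u)"

context banach_bimodule
begin

lemma complex_banach_algebra_ext: "complex_banach_algebra (ext_mul mul lact ract)"
proof
  fix u v w :: "('a, 'x) module_ext" and z :: complex
  show "ext_mul mul lact ract (ext_mul mul lact ract u v) w
      = ext_mul mul lact ract u (ext_mul mul lact ract v w)"
    by (simp add: ext_mul_def mul_assoc lact_mul ract_mul lact_ract lact_add_right ract_add_left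
        add.assoc)
  show "ext_mul mul lact ract (u + v) w = ext_mul mul lact ract u w + ext_mul mul lact ract v w"
    by (simp add: ext_mul_def module_ext_ops mul_add_left lact_add_left ract_add_left algebra_simps)
  show "ext_mul mul lact ract u (v + w) = ext_mul mul lact ract u v + ext_mul mul lact ract u w"
    by (simp add: ext_mul_def module_ext_ops mul_add_right lact_add_right ract_add_right
        algebra_simps)
  show "ext_mul mul lact ract (z *\<^sub>C u) v = z *\<^sub>C ext_mul mul lact ract u v"
    by (simp add: ext_mul_def module_ext_ops mul_scaleC_left lact_scaleC_left ract_scaleC_left
        scaleC_add_right)
  show "ext_mul mul lact ract u (z *\<^sub>C v) = z *\<^sub>C ext_mul mul lact ract u v"
    by (simp add: ext_mul_def module_ext_ops mul_scaleC_right lact_scaleC_right ract_scaleC_right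
        scaleC_add_right)
  have "norm (lact (alg_part u) (mod_part v) + ract (mod_part u) (alg_part v))
      \<le> norm (alg_part u) * norm (mod_part v) + norm (mod_part u) * norm (alg_part v)"
    by (intro norm_triangle_le add_mono norm_lact norm_ract)
  moreover have "0 \<le> norm (mod_part u) * norm (mod_part v)" by simp
  ultimately show "norm (ext_mul mul lact ract u v) \<le> norm u * norm v"
    using norm_mul[of "alg_part u" "alg_part v"]
    unfolding ext_mul_def norm_module_ext_def module_ext.sel distrib_left distrib_right
    by linarith
qed

lemma ext_char_characters:
  assumes "\<phi> \<in> characters mul"
  shows "(ext_char \<phi> :: ('a, 'x) module_ext \<Rightarrow> complex) \<in> characters (ext_mul mul lact ract)"
proof -
  obtain a where "\<phi> a \<noteq> 0" using assms by (auto simp: characters_def)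
  then have "ext_char \<phi> (Ext a (0 :: 'x)) \<noteq> 0" by (simp add: ext_char_def)
  then show ?thesis
    using assms unfolding characters_def
    by (intro CollectI conjI exI[of _ "Ext a 0"])
      (auto simp: clinear_iff ext_char_def ext_mul_def module_ext_ops)
qed

end


section \<open>Nets\<close>

definition directed_set :: "'i set \<Rightarrow> ('i \<Rightarrow> 'i \<Rightarrow> bool) \<Rightarrow> bool" where
  "directed_set I le \<longleftrightarrow>
    I \<noteq> {} \<and> reflp_on I le \<and> transp_on I le \<and> (\<forall>i\<in>I. \<forall>j\<in>I. \<exists>k\<in>I. le i k \<and> le j k)"

definition net_filter :: "'i set \<Rightarrow> ('i \<Rightarrow> 'i \<Rightarrow> bool) \<Rightarrow> 'i filter" where
  "net_filter I le = (INF i\<in>I. principal {j \<in> I. le i j})"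

lemma eventually_net_filter:
  assumes "directed_set I le"
  shows "eventually P (net_filter I le) \<longleftrightarrow> (\<exists>i\<in>I. \<forall>j\<in>I. le i j \<longrightarrow> P j)"
  unfolding net_filter_def
proof (subst eventually_INF_base)
  show "I \<noteq> {}" using assms by (simp add: directed_set_def)
  show "\<exists>k\<in>I. principal {l \<in> I. le k l} \<le> inf (principal {l \<in> I. le i l}) (principal {l \<in> I. le j l})"
    if "i \<in> I" "j \<in> I" for i j
  proof -
    obtain k where "k \<in> I" "le i k" "le j k"
      using assms \<open>i \<in> I\<close> \<open>j \<in> I\<close> unfolding directed_set_def by meson
    moreover have "transp_on I le" using assms by (simp add: directed_set_def)
    ultimately show ?thesis
      using that by (intro bexI[of _ k]) (auto dest: transp_onD)
  qed
qed (auto simp: eventually_principal)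

text \<open>The net \<open>(a\<^sub>\<alpha>, x\<^sub>\<alpha>)\<close> is \<open>u\<close>, indexed by the set \<open>I\<close> directed by \<open>le\<close>.
  HOL cannot quantify existentially over the index type. Pairs of a set of elements of \<open>A \<oplus> X\<close> and a
  natural number suffice: given any such net, choose for each finite set \<open>S\<close> and each \<open>n\<close> a
  late enough member whose commutators with the elements of \<open>S\<close> have norm at most \<open>1 / (n + 1)\<close>.\<close>

definition central_net ::
  "('a::complex_banach \<Rightarrow> 'a \<Rightarrow> 'a) \<Rightarrow> ('a \<Rightarrow> 'x::complex_banach \<Rightarrow> 'x) \<Rightarrow> ('x \<Rightarrow> 'a \<Rightarrow> 'x) \<Rightarrow>
    ('a \<Rightarrow> complex) \<Rightarrow> 'i set \<Rightarrow> ('i \<Rightarrow> 'i \<Rightarrow> bool) \<Rightarrow> ('i \<Rightarrow> ('a, 'x) module_ext) \<Rightarrow> bool" where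
  "central_net mul lact ract \<phi> I le u \<longleftrightarrow>
    directed_set I le \<and> bounded (u ` I) \<and>
    (\<forall>a. ((\<lambda>i. norm (mul a (alg_part (u i)) - mul (alg_part (u i)) a)) \<longlongrightarrow> 0) (net_filter I le)) \<and>
    (\<forall>i\<in>I. \<phi> (alg_part (u i)) = 1) \<and>
    (\<forall>x. ((\<lambda>i. norm (ract x (alg_part (u i)) - lact (alg_part (u i)) x)) \<longlongrightarrow> 0) (net_filter I le)) \<and>
    (\<forall>a. ((\<lambda>i. norm (lact a (mod_part (u i)) - ract (mod_part (u i)) a)) \<longlongrightarrow> 0) (net_filter I le))"

end

theory Submission
  imports Defs
begin

text \<open>Norm-asymptotically central bounded nets have weak* cluster points in the bidual, by
  Tychonoff's theorem, and such a point witnesses inner amenability. Conversely, let \<open>m\<close> be a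
  witness in the bidual. For finitely many elements \<open>b\<close>, the Hahn-Banach theorem in a finite power of
  the algebra yields \<open>u\<close> of norm at most \<open>\<parallel>m\<parallel>\<close> with all \<open>bu - ub\<close> small and \<open>\<phi> u\<close> close to \<open>1\<close>;
  rescaling makes \<open>\<phi> u = 1\<close>. On \<open>A \<oplus> X\<close>, the commutator of \<open>(a, x)\<close> and \<open>(a', x')\<close> is
  \<open>(aa' - a'a, (ax' - x'a) + (xa' - a'x))\<close>, so its norm tends to \<open>0\<close> for all \<open>(a, x)\<close> exactly under
  the three conditions on the net.\<close>

section \<open>Sublinear functionals and separation\<close>

text \<open>Only an inequality for positive scalars is required, which is what an infimum inherits
  directly. Applying it to the inverse scalar recovers positive homogeneity in
  \<open>sublinear_scaleR\<close>.\<close>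

definition sublinear :: "('v::real_vector \<Rightarrow> real) \<Rightarrow> bool" where
  "sublinear p \<longleftrightarrow> (\<forall>x y. p (x + y) \<le> p x + p y) \<and> (\<forall>t>0. \<forall>x. p (t *\<^sub>R x) \<le> t * p x)"

lemma sublinear_add: "sublinear p \<Longrightarrow> p (x + y) \<le> p x + p y"
  by (simp add: sublinear_def)

lemma sublinear_scaleR_le: "sublinear p \<Longrightarrow> 0 < t \<Longrightarrow> p (t *\<^sub>R x) \<le> t * p x"
  by (simp add: sublinear_def)

lemma sublinear_zero:
  assumes "sublinear p"
  shows "p 0 = 0"
  using sublinear_add[OF assms, of 0 0] sublinear_scaleR_le[OF assms, of "1/2" 0] by simp

lemma sublinear_scaleR:
  assumes "sublinear p" "0 \<le> t"
  shows "p (t *\<^sub>R x) = t * p x"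
proof (cases "t = 0")
  case True
  then show ?thesis using sublinear_zero[OF assms(1)] by simp
next
  case False
  then have t: "0 < t" using assms(2) by simp
  have "p (inverse t *\<^sub>R (t *\<^sub>R x)) \<le> inverse t * p (t *\<^sub>R x)"
    using assms(1) t by (intro sublinear_scaleR_le) auto
  then have "t * p x \<le> p (t *\<^sub>R x)"
    using t by (simp add: field_simps)
  with sublinear_scaleR_le[OF assms(1) t, of x] show ?thesis by simp
qed

lemma sublinear_minus_le:
  assumes "sublinear p"
  shows "- p (- x) \<le> p x"
  using sublinear_add[OF assms, of x "- x"] sublinear_zero[OF assms] by simp

text \<open>The infimum of \<open>p (x + z) - s\<close> over the convex cone \<open>C\<close> of
  pairs \<open>(z, s)\<close> works: \<open>s \<le> p z\<close> keeps it bounded below by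
  \<open>- p (- x)\<close>. It serves twice, with a ray to show that minimal functionals are linear
  and with the cone over a convex set to separate.\<close>

lemma sublinear_cone_INF:
  fixes p :: "'v::real_vector \<Rightarrow> real" and C :: "('v \<times> real) set"
  assumes p: "sublinear p"
    and zero: "(0, 0) \<in> C"
    and add: "\<And>c d. c \<in> C \<Longrightarrow> d \<in> C \<Longrightarrow> c + d \<in> C"
    and scale: "\<And>t c. 0 < t \<Longrightarrow> c \<in> C \<Longrightarrow> t *\<^sub>R c \<in> C"
    and le: "\<And>z s. (z, s) \<in> C \<Longrightarrow> s \<le> p z"
  obtains q where "sublinear q" "\<And>x. q x \<le> p x" "\<And>z s. (z, s) \<in> C \<Longrightarrow> q (- z) \<le> - s"
proof
  define q where "q x = (INF c\<in>C. p (x + fst c) - snd c)" for x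
  have bdd: "bdd_below ((\<lambda>c. p (x + fst c) - snd c) ` C)" for x
  proof (rule bdd_belowI2)
    fix c assume "c \<in> C"
    then have "snd c \<le> p (fst c)" using le[of "fst c" "snd c"] by simp
    moreover have "p (fst c) \<le> p (x + fst c) + p (- x)"
      using sublinear_add[OF p, of "x + fst c" "- x"] by simp
    ultimately show "- p (- x) \<le> p (x + fst c) - snd c" by simp
  qed
  have q_le: "q x \<le> p (x + z) - s" if "(z, s) \<in> C" for x z s
    unfolding q_def using cINF_lower[OF bdd that] by simp
  have q_ge: "l \<le> q x" if "\<And>z s. (z, s) \<in> C \<Longrightarrow> l \<le> p (x + z) - s" for l x
    unfolding q_def using zero that by (intro cINF_greatest) auto
  show "q x \<le> p x" for x using q_le[OF zero, of x] by simp
  show "q (- z) \<le> - s" if "(z, s) \<in> C" for z s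
    using q_le[OF that, of "- z"] sublinear_zero[OF p] by simp
  show "sublinear q"
    unfolding sublinear_def
  proof (intro conjI allI impI)
    fix x y
    \<comment> \<open>The infima defining \<open>q x\<close> and \<open>q y\<close> are taken one
      after the other: everything else is moved to the left so that \<open>q_ge\<close> applies to
      each in turn.\<close>
    have "q (x + y) - (p (x + z) - s) \<le> p (y + z') - s'" if "(z, s) \<in> C" "(z', s') \<in> C" for z s z' s'
      using q_le[OF add[OF that, simplified], of "x + y"] sublinear_add[OF p, of "x + z" "y + z'"]
      by (simp add: algebra_simps)
    then have le_y: "q (x + y) - (p (x + z) - s) \<le> q y" if "(z, s) \<in> C" for z s
      using that by (intro q_ge)
    have "q (x + y) - q y \<le> p (x + z) - s" if "(z, s) \<in> C" for z s
      using le_y[OF that] by linarith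
    then have "q (x + y) - q y \<le> q x" by (rule q_ge)
    then show "q (x + y) \<le> q x + q y" by simp
  next
    fix t :: real and x assume t: "0 < t"
    have "q (t *\<^sub>R x) / t \<le> p (x + z) - s" if "(z, s) \<in> C" for z s
    proof -
      have "q (t *\<^sub>R x) \<le> p (t *\<^sub>R (x + z)) - t * s"
        using q_le[OF scale[OF t that, simplified], of "t *\<^sub>R x"] by (simp add: algebra_simps)
      also have "\<dots> \<le> t * (p (x + z) - s)"
        using sublinear_scaleR_le[OF p t, of "x + z"] by (simp add: algebra_simps)
      finally show ?thesis using t by (simp add: field_simps)
    qed
    then have "q (t *\<^sub>R x) / t \<le> q x" by (rule q_ge)
    then show "q (t *\<^sub>R x) \<le> t * q x" using t by (simp add: field_simps)
  qed
qed

text \<open>The pointwise infimum is the lower bound that Zorn's lemma asks for. The common bound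
  \<open>p\<close> keeps it finite, and comparability of the members keeps it subadditive.\<close>

lemma sublinear_chain_INF:
  assumes nonempty: "Q \<noteq> {}"
    and sub: "\<And>q. q \<in> Q \<Longrightarrow> sublinear q"
    and bound: "\<And>q x. q \<in> Q \<Longrightarrow> q x \<le> p x"
    and chain: "\<And>q r. q \<in> Q \<Longrightarrow> r \<in> Q \<Longrightarrow> q \<le> r \<or> r \<le> q"
  obtains r where "sublinear r" "\<And>q. q \<in> Q \<Longrightarrow> r \<le> q"
proof
  define r where "r x = (INF q\<in>Q. q x)" for x
  have bdd: "bdd_below ((\<lambda>q. q x) ` Q)" for x
  proof (rule bdd_belowI2)
    show "- p (- x) \<le> q x" if "q \<in> Q" for q
      using bound[OF that, of "- x"] sublinear_minus_le[OF sub[OF that], of x] by linarith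
  qed
  have r_le: "r x \<le> q x" if "q \<in> Q" for q x
    unfolding r_def using cINF_lower[OF bdd that] by simp
  have r_ge: "l \<le> r x" if "\<And>q. q \<in> Q \<Longrightarrow> l \<le> q x" for l x
    unfolding r_def using nonempty that by (intro cINF_greatest) auto
  show "r \<le> q" if "q \<in> Q" for q
    using r_le[OF that] by (simp add: le_fun_def)
  show "sublinear r"
    unfolding sublinear_def
  proof (intro conjI allI impI)
    fix x y
    have "r (x + y) - q x \<le> q' y" if q: "q \<in> Q" "q' \<in> Q" for q q'
    proof -
      \<comment> \<open>The smaller of \<open>q\<close> and \<open>q'\<close> is used at both
        points, which bounds \<open>r (x + y)\<close> by \<open>q x + q' y\<close>.\<close>
      have "r (x + y) \<le> min (q x + q y) (q' x + q' y)"
        using r_le q sub sublinear_add by (metis min.boundedI order_trans)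
      moreover have "(\<forall>z. q z \<le> q' z) \<or> (\<forall>z. q' z \<le> q z)"
        using chain[OF q] by (simp add: le_fun_def)
      ultimately show ?thesis by (smt (verit))
    qed
    then have le_y: "r (x + y) - q x \<le> r y" if "q \<in> Q" for q
      using that by (intro r_ge)
    have "r (x + y) - r y \<le> q x" if "q \<in> Q" for q
      using le_y[OF that] by linarith
    then have "r (x + y) - r y \<le> r x" by (rule r_ge)
    then show "r (x + y) \<le> r x + r y" by simp
  next
    fix t :: real and x assume t: "0 < t"
    have "r (t *\<^sub>R x) / t \<le> q x" if "q \<in> Q" for q
      using order_trans[OF r_le[OF that] sublinear_scaleR_le[OF sub[OF that] t]] t
      by (simp add: field_simps)
    then have "r (t *\<^sub>R x) / t \<le> r x" by (rule r_ge)
    then show "r (t *\<^sub>R x) \<le> t * r x" using t by (simp add: field_simps)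
  qed
qed

text \<open>A minimal sublinear functional is linear: lowering it to
  \<open>x \<mapsto> inf {q (x + t y) - t q y | t \<ge> 0}\<close> changes nothing, which makes it superadditive.\<close>

lemma sublinear_dominates_linear:
  fixes p :: "'v::real_vector \<Rightarrow> real"
  assumes p: "sublinear p"
  obtains q where "linear q" "\<And>x. q x \<le> p x"
proof -
  define A where "A = {q. sublinear q \<and> q \<le> p}"
  \<comment> \<open>The order is reversed, so the maximal element from Zorn's lemma is a minimal
    sublinear functional below \<open>p\<close>.\<close>
  have "\<exists>q\<in>A. \<forall>r\<in>A. q \<ge> r \<longrightarrow> r = q"
  proof (rule predicate_Zorn)
    show "partial_order_on A (relation_of (\<lambda>q r. q \<ge> r) A)"
      by (rule partial_order_on_relation_ofI) auto
    fix Q assume Q: "Q \<in> Chains (relation_of (\<lambda>q r. q \<ge> r) A)"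
    then have QA: "Q \<subseteq> A" and chain: "\<And>q r. q \<in> Q \<Longrightarrow> r \<in> Q \<Longrightarrow> q \<le> r \<or> r \<le> q"
      by (auto simp: Chains_def relation_of_def)
    show "\<exists>u\<in>A. \<forall>q\<in>Q. q \<ge> u"
    proof (cases "Q = {}")
      case True
      then show ?thesis using p by (auto simp: A_def)
    next
      case False
      moreover have "sublinear q" "q x \<le> p x" if "q \<in> Q" for q x
        using QA that by (auto simp: A_def le_fun_def)
      ultimately obtain r where r: "sublinear r" "\<And>q. q \<in> Q \<Longrightarrow> r \<le> q"
        using chain sublinear_chain_INF[of Q p] by metis
      moreover have "r \<le> p"
        using False r(2) QA by (force simp: A_def intro: order_trans)
      ultimately show ?thesis by (auto simp: A_def)
    qed
  qed
  then obtain q where q: "sublinear q" "q \<le> p"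
    and min: "\<And>r. sublinear r \<Longrightarrow> r \<le> p \<Longrightarrow> r \<le> q \<Longrightarrow> r = q"
    by (auto simp: A_def)
  have super: "q x + q y \<le> q (x + y)" for x y
  proof -
    \<comment> \<open>Lowering \<open>q\<close> along the ray through \<open>(y, q y)\<close> gives
      \<open>r (- y) \<le> - q y\<close>. By minimality \<open>r = q\<close>, and subadditivity at
      \<open>(x + y) + (- y)\<close> becomes superadditivity at \<open>x + y\<close>.\<close>
    define C where "C = {(t *\<^sub>R y, t * q y) | t. 0 \<le> t}"
    obtain r where r: "sublinear r" "\<And>z. r z \<le> q z" "\<And>z s. (z, s) \<in> C \<Longrightarrow> r (- z) \<le> - s"
    proof (rule sublinear_cone_INF[of q C])
      show "(0, 0) \<in> C" by (auto simp: C_def)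
      show "c + d \<in> C" if cd: "c \<in> C" "d \<in> C" for c d
      proof -
        obtain s t where "c = (s *\<^sub>R y, s * q y)" "d = (t *\<^sub>R y, t * q y)" "0 \<le> s" "0 \<le> t"
          using cd by (auto simp: C_def)
        then show ?thesis
          unfolding C_def by (intro CollectI exI[of _ "s + t"]) (simp add: algebra_simps)
      qed
      show "t *\<^sub>R c \<in> C" if tc: "0 < t" "c \<in> C" for t c
      proof -
        obtain s where "c = (s *\<^sub>R y, s * q y)" "0 \<le> s"
          using tc by (auto simp: C_def)
        then show ?thesis
          using tc unfolding C_def by (intro CollectI exI[of _ "t * s"]) simp
      qed
      show "s \<le> q z" if "(z, s) \<in> C" for z s
        using that sublinear_scaleR[OF q(1)] by (auto simp: C_def)
    qed (use q in auto)
    have "(y, q y) \<in> C" unfolding C_def by (intro CollectI exI[of _ 1]) simp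
    then have "r (- y) \<le> - q y" by (rule r(3))
    moreover have "r = q"
      using r(1,2) q(2) by (intro min) (auto simp: le_fun_def intro: order_trans)
    moreover have "q x \<le> q (x + y) + q (- y)"
      using sublinear_add[OF q(1), of "x + y" "- y"] by simp
    ultimately show ?thesis by simp
  qed
  have add: "q (x + y) = q x + q y" for x y
    using super[of x y] sublinear_add[OF q(1), of x y] by simp
  have neg: "q (- x) = - q x" for x
    using add[of x "- x"] sublinear_zero[OF q(1)] by simp
  have "q (t *\<^sub>R x) = t *\<^sub>R q x" for t x
  proof (cases "0 \<le> t")
    case True
    then show ?thesis using sublinear_scaleR[OF q(1)] by simp
  next
    case False
    then show ?thesis using sublinear_scaleR[OF q(1), of "- t" x] neg[of "t *\<^sub>R x"] by simp
  qed
  with add have "linear q" by (intro linearI)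
  with q(2) that show ?thesis by (auto simp: le_fun_def)
qed

text \<open>The norm is lowered along the cone generated by the pairs
  \<open>(d, \<epsilon>)\<close>, where \<open>far\<close> is the required domination. A linear
  minorant \<open>q\<close> of the result has \<open>q (- d) \<le> - \<epsilon>\<close>, which
  linearity turns around.\<close>

lemma convex_norm_separation:
  fixes D :: "'v::real_normed_vector set"
  assumes D: "convex D" "D \<noteq> {}" and far: "\<And>d. d \<in> D \<Longrightarrow> \<epsilon> \<le> norm d"
  obtains q where "linear q" "\<And>x. q x \<le> norm x" "\<And>d. d \<in> D \<Longrightarrow> \<epsilon> \<le> q d"
proof -
  define C where "C = {(t *\<^sub>R d, t * \<epsilon>) | t d. 0 \<le> t \<and> d \<in> D}"
  obtain p where p: "sublinear p" "\<And>x. p x \<le> norm x" "\<And>z s. (z, s) \<in> C \<Longrightarrow> p (- z) \<le> - s"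
  proof (rule sublinear_cone_INF[of norm C])
    show "sublinear (norm :: 'v \<Rightarrow> real)"
      by (simp add: sublinear_def norm_triangle_ineq)
    show "(0, 0) \<in> C" using D(2) by (force simp: C_def)
    show "c + d \<in> C" if cd: "c \<in> C" "d \<in> C" for c d
    proof -
      obtain s x t y where st: "c = (s *\<^sub>R x, s * \<epsilon>)" "d = (t *\<^sub>R y, t * \<epsilon>)"
          "0 \<le> s" "0 \<le> t" "x \<in> D" "y \<in> D"
        using cd by (auto simp: C_def)
      show ?thesis
      proof (cases "s + t = 0")
        case True
        then have "s = 0" "t = 0" using st by auto
        then show ?thesis using st by (auto simp: C_def intro!: exI[of _ 0] exI[of _ x])
      next
        case False
        \<comment> \<open>Normalising the weights gives a convex combination, so the sum of two cone
          elements is \<open>s + t\<close> times a single pair over \<open>D\<close>.\<close>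
        define z where "z = (s / (s + t)) *\<^sub>R x + (t / (s + t)) *\<^sub>R y"
        have "z \<in> D"
          unfolding z_def using D(1) st False
          by (intro convexD) (auto simp: add_divide_distrib[symmetric])
        moreover have "(s + t) *\<^sub>R z = s *\<^sub>R x + t *\<^sub>R y"
          using False by (simp add: z_def scaleR_add_right)
        ultimately show ?thesis
          unfolding C_def using st
          by (intro CollectI exI[of _ "s + t"] exI[of _ z]) (simp add: algebra_simps)
      qed
    qed
    show "t *\<^sub>R c \<in> C" if tc: "0 < t" "c \<in> C" for t c
    proof -
      obtain s d where "c = (s *\<^sub>R d, s * \<epsilon>)" "0 \<le> s" "d \<in> D"
        using tc by (auto simp: C_def)
      then show ?thesis
        using tc unfolding C_def by (intro CollectI exI[of _ "t * s"] exI[of _ d]) simp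
    qed
    show "s \<le> norm z" if "(z, s) \<in> C" for z s
      using that far by (auto simp: C_def intro!: mult_left_mono)
  qed (use that in auto)
  obtain q where q: "linear q" "\<And>x. q x \<le> p x"
    using sublinear_dominates_linear[OF p(1)] by blast
  show thesis
  proof
    show "linear q" by (rule q(1))
    show "q x \<le> norm x" for x using q(2) p(2) by (rule order_trans)
    show "\<epsilon> \<le> q d" if "d \<in> D" for d
    proof -
      have "(d, \<epsilon>) \<in> C"
        unfolding C_def using that by (intro CollectI exI[of _ 1] exI[of _ d]) simp
      then have "q (- d) \<le> - \<epsilon>" using p(3) q(2) order_trans by blast
      then show ?thesis using linear_neg[OF q(1), of d] by simp
    qed
  qed
qed

section \<open>Approximation and cluster points in the bidual\<close>

lemma cdual_apply_add: "cdual_apply f (x + y) = cdual_apply f x + cdual_apply f y"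
  and cdual_apply_scaleC: "cdual_apply f (c *\<^sub>C x) = c * cdual_apply f x"
  using cdual_clinear[of f] by (simp_all add: clinear_iff)

lemma cdual_apply_zero: "cdual_apply f 0 = 0"
  using cdual_apply_add[of f 0 0] by simp

lemma cdual_apply_diff: "cdual_apply f (x - y) = cdual_apply f x - cdual_apply f y"
  using cdual_apply_add[of f "x - y" y] by simp

lemma cdual_apply_sum: "cdual_apply f (\<Sum>i\<in>S. x i) = (\<Sum>i\<in>S. cdual_apply f (x i))"
  by (induction S rule: infinite_finite_induct) (simp_all add: cdual_apply_zero cdual_apply_add)

lemma sum_cdual_apply: "cdual_apply (\<Sum>i\<in>S. f i) x = (\<Sum>i\<in>S. cdual_apply (f i) x)"
  by (induction S rule: infinite_finite_induct) (simp_all add: zero_cdual.rep_eq plus_cdual.rep_eq)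

text \<open>The standard complexification \<open>g w - i g (i w)\<close> of a real functional; it
  transfers the real separation result to complex duals.\<close>

lemma cdual_exists_Re:
  fixes g :: "'w::complex_normed_vector \<Rightarrow> real"
  assumes g: "linear g" and bound: "\<And>w. \<bar>g w\<bar> \<le> norm w"
  obtains f :: "'w cdual" where "\<And>w. Re (f w) = g w"
proof
  let ?f = "\<lambda>w. Complex (g w) (- g (\<i> *\<^sub>C w))"
  have add: "g (x + y) = g x + g y" for x y by (rule linear_add[OF g])
  have g_scaleC: "g (c *\<^sub>C w) = Re c * g w + Im c * g (\<i> *\<^sub>C w)" for c w
  proof -
    have "c *\<^sub>C w = Re c *\<^sub>R w + Im c *\<^sub>R (\<i> *\<^sub>C w)"
      using complex_eq[of c] scaleC_add_left[of "of_real (Re c)" "of_real (Im c) * \<i>" w]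
      by (simp add: scaleC_scaleC scaleC_of_real[symmetric] mult.commute)
    then show ?thesis by (simp add: add linear_scale[OF g])
  qed
  have f_scaleC: "?f (c *\<^sub>C w) = c * ?f w" for c w
    using g_scaleC[of c w] g_scaleC[of "\<i> * c" w]
    by (simp add: complex_eq_iff scaleC_scaleC)
  have "?f (v + w) = ?f v + ?f w" for v w
    by (simp add: complex_eq_iff scaleC_add_right add)
  with f_scaleC have lin: "clinear ?f"
    unfolding clinear_iff by blast
  \<comment> \<open>The crude factor 2 is harmless: only continuity of \<open>?f\<close> is
    needed.\<close>
  have "cmod (?f w) \<le> 2 * norm w" for w
    using cmod_le[of "?f w"] bound[of w] bound[of "\<i> *\<^sub>C w"] by (simp add: norm_scaleC)
  then have "cdual_apply (Cdual ?f) = ?f"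
    by (rule cdual_apply_Cdual[OF lin])
  then show "Re (cdual_apply (Cdual ?f) w) = g w" for w by simp
qed

text \<open>Each \<open>x\<close> can be rotated and scaled to the sphere of radius \<open>K\<close>
  so that \<open>h\<close> takes the value \<open>- K * cmod (h x) / norm x\<close> there. The lower
  bound at these points limits the operator norm.\<close>

lemma cdual_Re_lower_bound:
  fixes h :: "'b::complex_normed_vector cdual"
  assumes K: "0 \<le> K" and lower: "\<And>u. norm u \<le> K \<Longrightarrow> r \<le> Re (h u)"
  shows "r \<le> - (K * norm h)"
proof (cases "K = 0")
  case True
  then show ?thesis using lower[of 0] by (simp add: cdual_apply_zero)
next
  case False
  then have K: "0 < K" using K by simp
  have r: "r \<le> 0" using lower[of 0] K by (simp add: cdual_apply_zero)
  have "norm h \<le> - r / K"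
    unfolding norm_cdual.rep_eq
  proof (rule onorm_bound)
    show "0 \<le> - r / K" using r K by (intro divide_nonneg_pos) auto
    fix x
    show "cmod (h x) \<le> - r / K * norm x"
    proof (cases "h x = 0")
      case True
      then show ?thesis using r K by (simp add: mult_nonpos_nonneg divide_nonpos_pos)
    next
      case False
      then have x: "norm x > 0" by (auto simp: cdual_apply_zero)
      \<comment> \<open>\<open>w\<close> is the phase that makes \<open>h x\<close> real and
        nonnegative; \<open>z\<close> reverses the sign and adjusts the length to
        \<open>K\<close>.\<close>
      define w where "w = cnj (h x) / cmod (h x)"
      have w: "w * h x = cmod (h x)" "cmod w = 1"
        using False complex_norm_square[of "h x"]
        by (simp_all add: w_def norm_divide power2_eq_square divide_eq_eq mult.commute)
      define z where "z = - (of_real (K / norm x) * w)"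
      have "norm (z *\<^sub>C x) = K"
        using K x w(2) by (simp add: norm_scaleC z_def norm_mult norm_divide)
      then have "r \<le> Re (h (z *\<^sub>C x))" by (intro lower) simp
      also have "cdual_apply h (z *\<^sub>C x) = - of_real (K / norm x * cmod (h x))"
        by (simp add: cdual_apply_scaleC z_def mult.assoc w(1))
      finally have "r \<le> - (K / norm x * cmod (h x))" by simp
      then show ?thesis using K x by (simp add: field_simps)
    qed
  qed
  then show ?thesis using K by (simp add: field_simps)
qed

text \<open>Tuples of length \<open>n\<close> are encoded as sequences vanishing from
  \<open>n\<close> on. Every sequence is continuous on the discrete space of naturals, so the
  bounded continuous functions supply the maximum norm.\<close>

definition bcontfun_upto :: "nat \<Rightarrow> (nat \<Rightarrow> 'w::real_normed_vector) \<Rightarrow> nat \<Rightarrow>\<^sub>C 'w" where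
  "bcontfun_upto n v = Bcontfun (\<lambda>i. if i < n then v i else 0)"

lemma apply_bcontfun_upto: "bcontfun_upto n v i = (if i < n then v i else 0)"
proof -
  have "(\<lambda>i. if i < n then v i else 0) \<in> bcontfun"
    by (rule bcontfun_normI[where b = "\<Sum>i<n. norm (v i)"])
      (auto simp: sum_nonneg intro: member_le_sum)
  then show ?thesis by (simp add: bcontfun_upto_def Bcontfun_inverse)
qed

text \<open>Splitting a tuple into its coordinates turns a linear functional on tuples into a sum of
  functionals on the factors.\<close>

lemma bcontfun_upto_sum:
  "bcontfun_upto n v = (\<Sum>i<n. bcontfun_upto n (\<lambda>j. if j = i then v i else 0))"
proof (rule bcontfun_eqI)
  fix j
  have "apply_bcontfun (\<Sum>i\<in>S. f i) j = (\<Sum>i\<in>S. apply_bcontfun (f i) j)"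
    for S and f :: "nat \<Rightarrow> nat \<Rightarrow>\<^sub>C 'a"
    by (induction S rule: infinite_finite_induct) simp_all
  then have "(\<Sum>i<n. bcontfun_upto n (\<lambda>j. if j = i then v i else 0)) j
      = (\<Sum>i<n. if j = i then bcontfun_upto n v j else 0)"
    by (auto simp only: apply_bcontfun_upto intro!: sum.cong split: if_split)
  also have "\<dots> = bcontfun_upto n v j"
    by (simp only: sum.delta' finite_lessThan) (simp add: apply_bcontfun_upto)
  finally show "bcontfun_upto n v j = (\<Sum>i<n. bcontfun_upto n (\<lambda>j. if j = i then v i else 0)) j"
    by (rule sym)
qed

text \<open>Goldstine's and Mazur's theorems in one step: if there is no such \<open>u\<close>, a functional on the
  space of \<open>n\<close>-tuples strictly separates \<open>0\<close> from the tuples \<open>(L\<^sub>i u - y\<^sub>i)\<^sub>i\<close>, and pulling it back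
  along \<open>L\<close> gives \<open>h\<close> with \<open>Re (h u) \<ge> Re (m h) + \<epsilon>\<close> on the ball of radius \<open>\<parallel>m\<parallel>\<close>.\<close>

lemma bidual_norm_approximation:
  fixes m :: "'b::complex_normed_vector cdual cdual"
    and L :: "nat \<Rightarrow> 'b \<Rightarrow> 'w::complex_normed_vector"
  assumes L_add: "\<And>i x y. L i (x + y) = L i x + L i y"
    and L_scaleC: "\<And>i c x. L i (c *\<^sub>C x) = c *\<^sub>C L i x"
    and L_bound: "\<And>i x. norm (L i x) \<le> B i * norm x"
    and m: "\<And>i f. i < n \<Longrightarrow> m (Cdual (\<lambda>u. cdual_apply f (L i u))) = cdual_apply f (y i)"
    and \<epsilon>: "0 < \<epsilon>"
  obtains u where "norm u \<le> norm m" "\<And>i. i < n \<Longrightarrow> norm (L i u - y i) < \<epsilon>"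
proof (rule ccontr)
  assume "\<not> thesis"
  then have far: "\<exists>i<n. \<epsilon> \<le> norm (L i u - y i)" if "norm u \<le> norm m" for u
    using that \<open>\<And>u. norm u \<le> norm m \<Longrightarrow> (\<And>i. i < n \<Longrightarrow> norm (L i u - y i) < \<epsilon>) \<Longrightarrow> thesis\<close>
    by (meson not_le)
  define T where "T u = bcontfun_upto n (\<lambda>i. L i u - y i)" for u
  have L_scaleR: "L i (t *\<^sub>R x) = t *\<^sub>R L i x" for i t x
    by (simp add: scaleC_of_real[symmetric] L_scaleC)
  have "convex (T ` cball 0 (norm m))"
  proof (rule convexI)
    fix d e and s t :: real
    assume d: "d \<in> T ` cball 0 (norm m)" and e: "e \<in> T ` cball 0 (norm m)"
      and st: "0 \<le> s" "0 \<le> t" "s + t = 1"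
    obtain u v where u: "u \<in> cball 0 (norm m)" "d = T u" and v: "v \<in> cball 0 (norm m)" "e = T v"
      using d e by blast
    \<comment> \<open>As the weights add up to 1, \<open>T\<close> is affine despite the shift by
      \<open>y\<close>, so it maps the ball to a convex set.\<close>
    have "s *\<^sub>R y i + t *\<^sub>R y i = y i" for i
      using st by (simp add: scaleR_add_left[symmetric])
    then have "s *\<^sub>R (L i u - y i) + t *\<^sub>R (L i v - y i) = L i (s *\<^sub>R u + t *\<^sub>R v) - y i" for i
      by (simp add: L_add L_scaleR scaleR_diff_right algebra_simps)
    then have "s *\<^sub>R d + t *\<^sub>R e = T (s *\<^sub>R u + t *\<^sub>R v)"
      by (intro bcontfun_eqI) (simp add: u v T_def apply_bcontfun_upto)
    moreover have "s *\<^sub>R u + t *\<^sub>R v \<in> cball 0 (norm m)"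
      using u v st by (intro convexD[OF convex_cball]) auto
    ultimately show "s *\<^sub>R d + t *\<^sub>R e \<in> T ` cball 0 (norm m)" by blast
  qed
  moreover have "T ` cball 0 (norm m) \<noteq> {}" by simp
  moreover have "\<epsilon> \<le> norm d" if "d \<in> T ` cball 0 (norm m)" for d
  proof -
    from that obtain u where u: "norm u \<le> norm m" "d = T u" by auto
    obtain i where "i < n" "\<epsilon> \<le> norm (L i u - y i)" using far[OF u(1)] by blast
    then show ?thesis
      using norm_bounded[of "T u" i] u by (simp add: T_def apply_bcontfun_upto)
  qed
  ultimately obtain q where q: "linear q" "\<And>x. q x \<le> norm x"
    and q_ge: "\<And>d. d \<in> T ` cball 0 (norm m) \<Longrightarrow> \<epsilon> \<le> q d"
    using convex_norm_separation by blast
  have q_abs: "\<bar>q x\<bar> \<le> norm x" for x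
    using q(2)[of x] q(2)[of "- x"] linear_neg[OF q(1), of x] by simp
  define emb where "emb i w = bcontfun_upto n (\<lambda>j. if j = i then w else 0)" for i and w :: 'w
  \<comment> \<open>Restricting \<open>q\<close> to the coordinate \<open>i\<close> gives a real
    functional bounded by the norm, hence the real part of an element of the dual.\<close>
  have "\<exists>f :: 'w cdual. \<forall>w. Re (f w) = q (emb i w)" for i
  proof -
    have "emb i (v + w) = emb i v + emb i w" "emb i (t *\<^sub>R w) = t *\<^sub>R emb i w" for v w t
      by (auto intro!: bcontfun_eqI simp: emb_def apply_bcontfun_upto)
    then have "linear (\<lambda>w. q (emb i w))"
      by (intro linearI) (simp_all add: linear_add[OF q(1)] linear_scale[OF q(1)])
    moreover have "norm (emb i w) \<le> norm w" for w
      by (rule norm_bound) (simp add: emb_def apply_bcontfun_upto)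
    then have "\<bar>q (emb i w)\<bar> \<le> norm w" for w
      using q_abs order_trans by blast
    ultimately show ?thesis using cdual_exists_Re by metis
  qed
  then obtain f :: "nat \<Rightarrow> 'w cdual" where f: "\<And>i w. Re (f i w) = q (emb i w)"
    by metis
  have q_T: "q (T u) = Re (\<Sum>i<n. f i (L i u - y i))" for u
    unfolding T_def by (subst bcontfun_upto_sum)
      (simp add: linear_sum[OF q(1)] f emb_def)
  define h where "h = (\<Sum>i<n. Cdual (\<lambda>u. f i (L i u)))"
  have comp: "cdual_apply (Cdual (\<lambda>u. f i (L i u))) u = f i (L i u)" for i u
  proof -
    have "clinear (\<lambda>u. f i (L i u))"
      by (simp add: clinear_iff L_add L_scaleC cdual_apply_add cdual_apply_scaleC)
    moreover have "cmod (f i (L i u)) \<le> (norm (f i) * B i) * norm u" for u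
      using order_trans[OF cdual_norm_le mult_left_mono[OF L_bound norm_ge_zero]]
      by (simp add: mult.assoc)
    ultimately show ?thesis by (subst cdual_apply_Cdual) auto
  qed
  have m_h: "m h = (\<Sum>i<n. f i (y i))"
    by (simp add: h_def cdual_apply_sum m)
  have "Re (m h) + \<epsilon> \<le> Re (h u)" if "norm u \<le> norm m" for u
  proof -
    have "\<epsilon> \<le> q (T u)" using q_ge that by simp
    also have "\<dots> = Re (h u) - Re (m h)"
      unfolding q_T m_h by (simp add: h_def sum_cdual_apply comp cdual_apply_diff sum_subtractf)
    finally show ?thesis by simp
  qed
  \<comment> \<open>On the ball of radius \<open>norm m\<close>, \<open>Re h\<close> has infimum
    \<open>- (norm m * norm h)\<close>, and \<open>Re (m h)\<close> cannot lie below that value.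
    This contradicts the gap \<open>\<epsilon>\<close>.\<close>
  then have "Re (m h) + \<epsilon> \<le> - (norm m * norm h)"
    by (intro cdual_Re_lower_bound) auto
  moreover have "- Re (m h) \<le> norm m * norm h"
    using cdual_norm_le[of m h] abs_Re_le_cmod[of "m h"] by linarith
  ultimately show False using \<epsilon> by linarith
qed

text \<open>The evaluations at \<open>u i\<close> eventually lie in a product of closed discs,
  compact by Tychonoff's theorem. A cluster point for pointwise convergence inherits linearity and
  the bound, and agrees with every limit that exists along \<open>F\<close>.\<close>

lemma bidual_cluster_point:
  fixes u :: "'i \<Rightarrow> 'b::complex_normed_vector" and F :: "'i filter"
  assumes F: "F \<noteq> bot" and bound: "\<forall>\<^sub>F i in F. norm (u i) \<le> K"
  obtains m :: "'b cdual cdual"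
    where "\<And>f c. ((\<lambda>i. cdual_apply f (u i)) \<longlongrightarrow> c) F \<Longrightarrow> m f = c"
proof -
  define U where "U = (\<Pi>\<^sub>E f\<in>(UNIV :: 'b cdual set). cball (0 :: complex) (K * norm f))"
  have "compactin (product_topology (\<lambda>f. euclidean) UNIV) U"
    unfolding U_def by (subst compactin_PiE) auto
  then have U: "compact U" by (simp add: euclidean_product_topology)
  define G where "G = filtermap (\<lambda>i f. cdual_apply f (u i)) F"
  have "\<forall>\<^sub>F h in G. h \<in> U"
    unfolding G_def eventually_filtermap using bound
  proof eventually_elim
    case (elim i)
    have "cmod (cdual_apply f (u i)) \<le> K * norm f" for f
      using order_trans[OF cdual_norm_le mult_left_mono[OF elim norm_ge_zero], of f]
      by (simp add: mult.commute)
    then show ?case by (simp add: U_def PiE_iff)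
  qed
  moreover have "G \<noteq> bot" using F by (simp add: G_def filtermap_bot_iff)
  \<comment> \<open>The filter \<open>inf (nhds g) G\<close> refines both parts and is proper: along
    it coordinates tend to those of \<open>g\<close>, limits are unique, and identities true of all
    evaluations pass to \<open>g\<close>.\<close>
  ultimately obtain g where g: "g \<in> U" and H: "inf (nhds g) G \<noteq> bot"
    using U unfolding compact_filter by blast
  have proj: "((\<lambda>h. h f) \<longlongrightarrow> g f) (inf (nhds g) G)" for f
  proof -
    have "continuous_on UNIV (\<lambda>h :: 'b cdual \<Rightarrow> complex. h f)" by simp
    then have "((\<lambda>h. h f) \<longlongrightarrow> g f) (nhds g)"
      using tendsto_at_iff_tendsto_nhds[of "\<lambda>h. h f" g] by (simp add: continuous_on_def)
    then show ?thesis by (rule tendsto_mono[OF inf_le1])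
  qed
  have ev: "eventually P (inf (nhds g) G)" if "\<And>i. P (\<lambda>f. cdual_apply f (u i))" for P
    by (rule filter_leD[OF inf_le2]) (simp add: G_def eventually_filtermap that)
  have "g (f + f') = g f + g f'" for f f'
  proof -
    have "((\<lambda>h. h f + h f') \<longlongrightarrow> g (f + f')) (inf (nhds g) G)"
      by (rule Lim_transform_eventually[OF proj]) (rule ev, simp add: plus_cdual.rep_eq)
    then show ?thesis using tendsto_unique[OF H _ tendsto_add[OF proj proj]] by blast
  qed
  moreover have "g (c *\<^sub>C f) = c * g f" for c f
  proof -
    have "((\<lambda>h. c * h f) \<longlongrightarrow> g (c *\<^sub>C f)) (inf (nhds g) G)"
      by (rule Lim_transform_eventually[OF proj]) (rule ev, simp add: scaleC_cdual.rep_eq)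
    then show ?thesis using tendsto_unique[OF H _ tendsto_mult_left[OF proj]] by blast
  qed
  ultimately have "clinear g" by (simp add: clinear_iff)
  moreover have "cmod (g f) \<le> K * norm f" for f
    using g by (auto simp: U_def)
  ultimately have g_Cdual: "cdual_apply (Cdual g) = g"
    by (rule cdual_apply_Cdual)
  show thesis
  proof (rule that)
    fix f c assume "((\<lambda>i. cdual_apply f (u i)) \<longlongrightarrow> c) F"
    then have "((\<lambda>h. h f) \<longlongrightarrow> c) G"
      by (simp add: G_def filterlim_filtermap)
    then have "((\<lambda>h. h f) \<longlongrightarrow> c) (inf (nhds g) G)"
      by (rule tendsto_mono[OF inf_le2])
    then show "cdual_apply (Cdual g) f = c"
      using tendsto_unique[OF H proj] g_Cdual by simp
  qed
qed

section \<open>Inner amenability and central nets\<close>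

text \<open>The bound \<open>K\<close> does not depend on \<open>S\<close> or
  \<open>\<epsilon>\<close>, which is what makes the later net bounded. Its value is twice the norm
  of the witness, the factor 2 being the cost of rescaling.\<close>

lemma inner_amenable_imp_approximately_central:
  assumes alg: "complex_banach_algebra mul" and \<phi>: "\<phi> \<in> characters mul"
    and amenable: "inner_amenable mul \<phi>"
  obtains K where "\<And>S \<epsilon>. finite S \<Longrightarrow> 0 < \<epsilon> \<Longrightarrow>
    \<exists>u. norm u \<le> K \<and> \<phi> u = 1 \<and> (\<forall>b\<in>S. norm (mul b u - mul u b) < \<epsilon>)"
proof -
  interpret complex_banach_algebra mul by (rule alg)
  have \<phi>_lin: "\<phi> (x + y) = \<phi> x + \<phi> y" "\<phi> (c *\<^sub>C x) = c * \<phi> x" for x y c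
    using \<phi> by (auto simp: characters_def clinear_iff)
  obtain m where m: "cdual_apply m (Cdual \<phi>) = 1"
    "\<And>f a. cdual_apply m (dual_right mul f a) = cdual_apply m (dual_left mul a f)"
    using amenable by (auto simp: inner_amenable_def)
  \<comment> \<open>Multiplying by \<open>e\<close> makes the scalar condition on
    \<open>\<phi> u\<close> algebra-valued, so that it can be a coordinate of \<open>L\<close>
    beside the commutators.\<close>
  obtain e where e: "\<phi> e = 1"
  proof -
    obtain a where "\<phi> a \<noteq> 0" using \<phi> by (auto simp: characters_def)
    then have "\<phi> (inverse (\<phi> a) *\<^sub>C a) = 1" by (simp add: \<phi>_lin)
    then show thesis by (rule that)
  qed
  have "\<exists>u. norm u \<le> 2 * norm m \<and> \<phi> u = 1 \<and> (\<forall>b\<in>S. norm (mul b u - mul u b) < \<epsilon>)"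
    if S: "finite S" and \<epsilon>: "0 < \<epsilon>" for S \<epsilon>
  proof -
    obtain bs where bs: "set bs = S" using finite_list[OF S] by blast
    define n where "n = length bs"
    define L where
      "L i u = (if i < n then mul (bs ! i) u - mul u (bs ! i) else \<phi> u *\<^sub>C e)" for i u
    define y where "y i = (if i < n then 0 else e)" for i
    have scaleC_diff: "c *\<^sub>C (x - z) = c *\<^sub>C x - c *\<^sub>C z" for c and x z :: 'a
      using scaleC_add_right[of c "x - z" z] by simp
    \<comment> \<open>The indices below \<open>n\<close> are commutators with target 0, and index
      \<open>n\<close> is \<open>\<phi> u\<close> times \<open>e\<close> with target
      \<open>e\<close>. The tolerance \<open>1 / 2\<close> keeps \<open>\<phi> u\<close> away from
      0, and \<open>\<epsilon> / 2\<close> absorbs the rescaling.\<close>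
    obtain u where u: "norm u \<le> norm m"
      "\<And>i. i < Suc n \<Longrightarrow> norm (L i u - y i) < min (1 / 2) (\<epsilon> / 2)"
    proof (rule bidual_norm_approximation)
      show "L i (x + z) = L i x + L i z" for i x z
        by (simp add: L_def mul_add_left mul_add_right \<phi>_lin scaleC_add_left)
      show "L i (c *\<^sub>C x) = c *\<^sub>C L i x" for i c x
        by (simp add: L_def mul_scaleC_left mul_scaleC_right \<phi>_lin scaleC_diff scaleC_scaleC)
      show "norm (L i x) \<le> (if i < n then 2 * norm (bs ! i) else norm e) * norm x" for i x
        using norm_triangle_ineq4[of "mul (bs ! i) x" "mul x (bs ! i)"]
          norm_mul[of "bs ! i" x] norm_mul[of x "bs ! i"]
          mult_right_mono[OF character_norm_le[OF \<phi>, of x] norm_ge_zero[of e]]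
        by (auto simp: L_def norm_scaleC mult.commute)
      show "m (Cdual (\<lambda>u. cdual_apply f (L i u))) = cdual_apply f (y i)" if "i < Suc n" for i f
      proof (cases "i < n")
        case True
        \<comment> \<open>Pulling \<open>f\<close> back along the commutator with \<open>b\<close>
          gives the difference of its two module translates by \<open>b\<close>, which
          \<open>m\<close> annihilates.\<close>
        have "(\<lambda>u. cdual_apply f (L i u))
            = cdual_apply (dual_right mul f (bs ! i) - dual_left mul (bs ! i) f)"
          using True by (simp add: fun_eq_iff L_def minus_cdual.rep_eq dual_right_apply
              dual_left_apply cdual_apply_diff)
        then show ?thesis
          using True m(2) by (simp add: cdual_apply_inverse cdual_apply_diff y_def cdual_apply_zero)
      next
        case False
        have "(\<lambda>u. cdual_apply f (L i u)) = cdual_apply (cdual_apply f e *\<^sub>C Cdual \<phi>)"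
          using False by (simp add: fun_eq_iff L_def scaleC_cdual.rep_eq Cdual_character[OF \<phi>]
              cdual_apply_scaleC mult.commute)
        then show ?thesis
          using False m(1) by (simp add: cdual_apply_inverse cdual_apply_scaleC y_def)
      qed
      show "0 < min (1 / 2) (\<epsilon> / 2)" using \<epsilon> by simp
    qed auto
    have "cmod (\<phi> u - 1) < 1 / 2"
    proof -
      \<comment> \<open>As \<open>\<phi> e = 1\<close>, \<open>\<phi> d\<close> equals
        \<open>\<phi> u - 1\<close>; contractivity of \<open>\<phi>\<close> then gives a bound free
        of \<open>norm e\<close>.\<close>
      define d where "d = L n u - y n"
      have "\<phi> u = \<phi> d + 1"
        using \<phi>_lin(1)[of d "y n"] by (simp add: d_def L_def y_def \<phi>_lin e)
      then show ?thesis
        using character_norm_le[OF \<phi>, of d] u(2)[of n] by (simp add: d_def)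
    qed
    then have \<phi>u: "1 / 2 < cmod (\<phi> u)"
      using norm_triangle_ineq2[of 1 "1 - \<phi> u"] by (simp add: norm_minus_commute)
    then have nz: "\<phi> u \<noteq> 0" by auto
    have scale: "norm (inverse (\<phi> u) *\<^sub>C x) \<le> 2 * norm x" for x :: 'a
    proof -
      have "inverse (cmod (\<phi> u)) \<le> 2"
        using le_imp_inverse_le[of "1 / 2" "cmod (\<phi> u)"] \<phi>u by simp
      then show ?thesis by (simp add: norm_scaleC norm_inverse mult_right_mono)
    qed
    show ?thesis
    proof (intro exI conjI ballI)
      show "norm (inverse (\<phi> u) *\<^sub>C u) \<le> 2 * norm m" using scale[of u] u(1) by simp
      show "\<phi> (inverse (\<phi> u) *\<^sub>C u) = 1" using nz by (simp add: \<phi>_lin)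
      fix b assume "b \<in> S"
      then obtain i where i: "i < n" "b = bs ! i"
        using bs by (auto simp: n_def in_set_conv_nth)
      then have "norm (mul b u - mul u b) < \<epsilon> / 2"
        using u(2)[of i] by (simp add: L_def y_def)
      then have "norm (inverse (\<phi> u) *\<^sub>C (mul b u - mul u b)) < \<epsilon>"
        using scale[of "mul b u - mul u b"] by linarith
      then show "norm (mul b (inverse (\<phi> u) *\<^sub>C u) - mul (inverse (\<phi> u) *\<^sub>C u) b) < \<epsilon>"
        by (simp add: scaleC_diff mul_scaleC_left mul_scaleC_right)
    qed
  qed
  then show thesis by (rule that)
qed

text \<open>A cluster point in the bidual is the witness: each \<open>f\<close> sends the
  commutators to values tending to 0, so the two translates of \<open>f\<close> get the same value,
  and \<open>\<phi>\<close> gets its eventual value 1.\<close>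

lemma inner_amenable_if_asymptotically_central:
  fixes F :: "'i filter"
  assumes alg: "complex_banach_algebra mul" and \<phi>: "\<phi> \<in> characters mul"
    and F: "F \<noteq> bot" and bound: "\<forall>\<^sub>F i in F. norm (u i) \<le> K"
    and unital: "\<forall>\<^sub>F i in F. \<phi> (u i) = 1"
    and central: "\<And>b. ((\<lambda>i. norm (mul b (u i) - mul (u i) b)) \<longlongrightarrow> 0) F"
  shows "inner_amenable mul \<phi>"
proof -
  interpret complex_banach_algebra mul by (rule alg)
  obtain m where m: "\<And>f c. ((\<lambda>i. cdual_apply f (u i)) \<longlongrightarrow> c) F \<Longrightarrow> cdual_apply m f = c"
    using bidual_cluster_point[OF F bound] by blast
  have "cdual_apply m (Cdual \<phi>) = 1"
    by (rule m) (simp add: Cdual_character[OF \<phi>] tendsto_eventually unital)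
  moreover have "cdual_apply m (dual_right mul f b) = cdual_apply m (dual_left mul b f)" for f b
  proof -
    have "((\<lambda>i. cdual_apply f (mul b (u i) - mul (u i) b)) \<longlongrightarrow> 0) F"
      by (rule Lim_null_comparison[OF _ tendsto_mult_right_zero[OF central[of b], of "norm f"]])
        (simp add: cdual_norm_le)
    then have "cdual_apply m (dual_right mul f b - dual_left mul b f) = 0"
      by (intro m) (simp add: minus_cdual.rep_eq dual_right_apply dual_left_apply cdual_apply_diff)
    then show ?thesis by (simp add: cdual_apply_diff)
  qed
  ultimately show ?thesis by (auto simp: inner_amenable_def)
qed

section \<open>Commutators in the module extension and the conditions on the net\<close>

lemma ext_mul_commutator:
  "ext_mul mul lact ract (Ext a x) u - ext_mul mul lact ract u (Ext a x) =
    Ext (mul a (alg_part u) - mul (alg_part u) a)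
      ((lact a (mod_part u) - ract (mod_part u) a) + (ract x (alg_part u) - lact (alg_part u) x))"
  by (simp add: ext_mul_def minus_module_ext_def)

lemma central_net_imp_inner_amenable:
  assumes bimod: "banach_bimodule mul lact ract" and \<phi>: "\<phi> \<in> characters mul"
    and net: "central_net mul lact ract \<phi> I le u"
  shows "inner_amenable (ext_mul mul lact ract) (ext_char \<phi>)"
proof -
  interpret banach_bimodule mul lact ract by (rule bimod)
  have dir: "directed_set I le" using net by (simp add: central_net_def)
  have all: "eventually P (net_filter I le)" if "\<And>i. i \<in> I \<Longrightarrow> P i" for P
    using dir that by (auto simp: eventually_net_filter directed_set_def)
  obtain K where K: "\<And>i. i \<in> I \<Longrightarrow> norm (u i) \<le> K"
    using net by (auto simp: central_net_def bounded_iff)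
  show ?thesis
  proof (rule inner_amenable_if_asymptotically_central[OF complex_banach_algebra_ext
        ext_char_characters[OF \<phi>]])
    show "net_filter I le \<noteq> bot"
      \<comment> \<open>By reflexivity each tail contains its starting index, so no tail is
        empty.\<close>
      using dir by (auto simp: trivial_limit_def eventually_net_filter directed_set_def
          dest: reflp_onD)
    show "\<forall>\<^sub>F i in net_filter I le. norm (u i) \<le> K" by (rule all) (rule K)
    show "\<forall>\<^sub>F i in net_filter I le. ext_char \<phi> (u i) = 1"
      by (rule all) (use net in \<open>simp add: central_net_def ext_char_def\<close>)
    fix b :: "('a, 'b) module_ext"
    obtain a x where b: "b = Ext a x" by (cases b)
    \<comment> \<open>The triangle inequality in the module part bounds the commutator with
      \<open>Ext a x\<close> by three terms, one for each limit condition on the net.\<close>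
    let ?d = "\<lambda>i. norm (mul a (alg_part (u i)) - mul (alg_part (u i)) a)
      + (norm (lact a (mod_part (u i)) - ract (mod_part (u i)) a)
        + norm (ract x (alg_part (u i)) - lact (alg_part (u i)) x))"
    have "(?d \<longlongrightarrow> 0 + (0 + 0)) (net_filter I le)"
      using net by (intro tendsto_add) (simp_all add: central_net_def)
    then have "(?d \<longlongrightarrow> 0) (net_filter I le)" by simp
    then show "((\<lambda>i. norm (ext_mul mul lact ract b (u i) - ext_mul mul lact ract (u i) b)) \<longlongrightarrow> 0)
        (net_filter I le)"
      by (rule Lim_null_comparison[of _ ?d, rotated])
        (simp_all add: b ext_mul_commutator norm_module_ext_def norm_triangle_ineq)
  qed
qed

lemma inner_amenable_imp_central_net:
  fixes mul :: "'a::complex_banach \<Rightarrow> 'a \<Rightarrow> 'a"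
    and lact :: "'a \<Rightarrow> 'x::complex_banach \<Rightarrow> 'x"
  assumes bimod: "banach_bimodule mul lact ract" and \<phi>: "\<phi> \<in> characters mul"
    and amenable: "inner_amenable (ext_mul mul lact ract) (ext_char \<phi>)"
  obtains I :: "(('a, 'x) module_ext set \<times> nat) set" and le u
    where "central_net mul lact ract \<phi> I le u"
proof -
  interpret banach_bimodule mul lact ract by (rule bimod)
  let ?mul = "ext_mul mul lact ract"
  obtain K where K: "\<And>S \<epsilon>. finite S \<Longrightarrow> 0 < \<epsilon> \<Longrightarrow>
      \<exists>u. norm u \<le> K \<and> ext_char \<phi> u = 1 \<and> (\<forall>b\<in>S. norm (?mul b u - ?mul u b) < \<epsilon>)"
    using inner_amenable_imp_approximately_central[OF complex_banach_algebra_ext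
        ext_char_characters[OF \<phi>] amenable] by blast
  \<comment> \<open>The index \<open>(S, n)\<close> asks for commutators with all elements of the
    finite set \<open>S\<close> of norm below \<open>1 / (n + 1)\<close>; larger sets and larger
    \<open>n\<close> come later.\<close>
  define I :: "(('a, 'x) module_ext set \<times> nat) set" where "I = {i. finite (fst i)}"
  define le where "le i j \<longleftrightarrow> fst i \<subseteq> fst j \<and> snd i \<le> snd j"
    for i j :: "('a, 'x) module_ext set \<times> nat"
  have "\<forall>i\<in>I. \<exists>u. norm u \<le> K \<and> ext_char \<phi> u = 1 \<and>
      (\<forall>b\<in>fst i. norm (?mul b u - ?mul u b) < inverse (Suc (snd i)))"
    using K by (simp add: I_def)
  then obtain u where u: "\<And>i. i \<in> I \<Longrightarrow> norm (u i) \<le> K" "\<And>i. i \<in> I \<Longrightarrow> ext_char \<phi> (u i) = 1"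
    "\<And>i b. i \<in> I \<Longrightarrow> b \<in> fst i \<Longrightarrow> norm (?mul b (u i) - ?mul (u i) b) < inverse (Suc (snd i))"
    by metis
  have dir: "directed_set I le"
    unfolding directed_set_def
  proof (intro conjI ballI)
    show "I \<noteq> {}" by (auto simp: I_def)
    show "reflp_on I le" by (auto simp: le_def intro!: reflp_onI)
    show "transp_on I le" by (rule transp_onI) (auto simp only: le_def intro: subset_trans le_trans)
    fix i j assume "i \<in> I" "j \<in> I"
    then show "\<exists>k\<in>I. le i k \<and> le j k"
      by (intro bexI[of _ "(fst i \<union> fst j, max (snd i) (snd j))"]) (auto simp: I_def le_def)
  qed
  \<comment> \<open>Whatever is dominated by the commutator with one fixed \<open>b\<close> tends to
    0, since \<open>b\<close> belongs to the set of every index beyond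
    \<open>({b}, n)\<close>.\<close>
  have null: "(g \<longlongrightarrow> 0) (net_filter I le)"
    if g: "\<And>i. 0 \<le> g i" "\<And>i. g i \<le> norm (?mul b (u i) - ?mul (u i) b)" for g :: "_ \<Rightarrow> real" and b
  proof (rule tendstoI)
    fix e :: real assume "0 < e"
    then obtain n where n: "inverse (Suc n) < e" using reals_Archimedean by blast
    have "dist (g i) 0 < e" if i: "i \<in> I" "le ({b}, n) i" for i
    proof -
      have "g i < inverse (Suc (snd i))"
        using g(2)[of i] u(3)[OF i(1), of b] i(2) by (simp add: le_def)
      also have "\<dots> \<le> inverse (Suc n)"
        using i(2) by (simp add: le_def)
      finally show ?thesis using n g(1)[of i] by simp
    qed
    moreover have "({b}, n) \<in> I" by (simp add: I_def)
    ultimately show "\<forall>\<^sub>F i in net_filter I le. dist (g i) 0 < e"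
      unfolding eventually_net_filter[OF dir] by blast
  qed
  have zero: "lact 0 x = 0" "ract 0 a = 0" "mul 0 a = 0" "mul a 0 = 0" "lact a 0 = 0" "ract x 0 = 0" for a x
    using lact_add_left[of 0 0 x] ract_add_left[of 0 0 a] mul_add_left[of 0 0 a] mul_add_right[of a 0 0]
      lact_add_right[of a 0 0] ract_add_right[of x 0 0] by simp_all
  have "central_net mul lact ract \<phi> I le u"
    unfolding central_net_def
  proof (intro conjI allI ballI)
    show "bounded (u ` I)" unfolding bounded_iff using u(1) by (intro exI[of _ K]) blast
    show "\<phi> (alg_part (u i)) = 1" if "i \<in> I" for i using u(2)[OF that] by (simp add: ext_char_def)
    fix a x
    \<comment> \<open>Testing with \<open>Ext a 0\<close> gives the two conditions on
      \<open>a\<close>, and testing with \<open>Ext 0 x\<close> gives the one on \<open>x\<close>: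
      the remaining terms of the module part vanish.\<close>
    show "((\<lambda>i. norm (mul a (alg_part (u i)) - mul (alg_part (u i)) a)) \<longlongrightarrow> 0) (net_filter I le)"
      by (rule null[of _ "Ext a 0"]) (simp_all add: ext_mul_commutator norm_module_ext_def)
    show "((\<lambda>i. norm (lact a (mod_part (u i)) - ract (mod_part (u i)) a)) \<longlongrightarrow> 0) (net_filter I le)"
      by (rule null[of _ "Ext a 0"]) (simp_all add: ext_mul_commutator norm_module_ext_def zero)
    show "((\<lambda>i. norm (ract x (alg_part (u i)) - lact (alg_part (u i)) x)) \<longlongrightarrow> 0) (net_filter I le)"
      by (rule null[of _ "Ext 0 x"]) (simp_all add: ext_mul_commutator norm_module_ext_def zero)
  qed (rule dir)
  then show thesis by (rule that)
qed

text \<open>The equivalence fixes one index type; the second conjunct, in which \<open>'i\<close> is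
  arbitrary, adds that a net over any index type suffices for inner amenability.\<close>

theorem proposition5p4:
  fixes mul :: "'a::complex_banach \<Rightarrow> 'a \<Rightarrow> 'a"
    and lact :: "'a \<Rightarrow> 'x::complex_banach \<Rightarrow> 'x"
    and ract :: "'x \<Rightarrow> 'a \<Rightarrow> 'x"
    and \<phi> :: "'a \<Rightarrow> complex"
  assumes "banach_bimodule mul lact ract"
    and "\<phi> \<in> characters mul"
  shows "(inner_amenable (ext_mul mul lact ract) (ext_char \<phi>) \<longleftrightarrow>
      (\<exists>(I :: (('a, 'x) module_ext set \<times> nat) set) le u. central_net mul lact ract \<phi> I le u)) \<and>
    ((\<exists>(J :: 'i set) le u. central_net mul lact ract \<phi> J le u) \<longrightarrow>
      inner_amenable (ext_mul mul lact ract) (ext_char \<phi>))"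
proof (intro conjI iffI impI)
  assume "inner_amenable (ext_mul mul lact ract) (ext_char \<phi>)"
  then show "\<exists>(I :: (('a, 'x) module_ext set \<times> nat) set) le u. central_net mul lact ract \<phi> I le u"
    by (rule inner_amenable_imp_central_net[OF assms]) (intro exI)
qed (auto intro: central_net_imp_inner_amenable[OF assms])

end
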